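(* Let $C$ be a curve in a Myller configuration $M(C,\bar\xi,\pi)$ with Frenet-type frame $R_F=\{P(s);\bar\xi_1,\bar\xi_2,\bar\xi_3\}$ and (nowhere) non-zero curvatures $K_1,K_2$. Then $C$ is a $\bar\xi_1$-helix (equivalently, a $\bar\xi_3$-helix) if and only if $$\bar\xi_1'''-\left[\frac{(K_1K_2)'}{K_1K_2}+\frac{K_1'}{K_1}\right]\bar\xi_1''+\left\{K_1K_2\left[\frac1{K_2}\left(\frac1{K_1}\right)'\right]'+K_1^2+K_2^2\right\}\bar\xi_1'=0.$$
   Context: All data are smooth. Let $C$ be a curve in Euclidean space $E^3$ with arclength parameter $s\in I$ ($I$ an interval) and position vector $\bar r(s)$, let $\bar\xi(s)$ be a unit vector field along $C$ (a versor field $(C,\bar\xi)$), and let $\pi(s)$ be a plane field along $C$ with $\bar\xi(s)\in\pi(s)$. The pair $((C,\bar\xi),(C,\pi))$ is called a Myller configuration $M=M(C,\bar\xi,\pi)$. Put $\bar\xi_1=\bar\xi$, $K_1=\|d\bar\xi/ds\|>0$ (curvature), define $\bar\xi_2$ by $\bar\xi_1'=K_1\bar\xi_2$, and $\bar\xi_3=\bar\xi_1\times\bar\xi_2$. Then $R_F=\{P(s);\bar\xi_1,\bar\xi_2,\bar\xi_3\}$ is a positively oriented orthonormal frame, the Frenet-type frame, and $$\bar\xi_1'=K_1\bar\xi_2,\quad \bar\xi_2'=-K_1\bar\xi_1+K_2\bar\xi_3,\quad \bar\xi_3'=-K_2\bar\xi_2,$$ which defines the torsion $K_2$. A prime denotes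 $d/ds$. The curve $C$ is called a $\bar\xi_i$-helix ($i=1,2,3$) if $\bar\xi_i$ makes a constant angle with a constant direction (a fixed unit vector). *)

theory Defs
  imports "HOL-Analysis.Analysis"
begin

text \<open>
  All derivatives are taken relative to the parameter interval \<open>I\<close>, hence they are one-sided at
  endpoints belonging to \<open>I\<close>. The same operator serves scalar and vector functions.
\<close>

definition dds :: "real set \<Rightarrow> (real \<Rightarrow> 'a::real_normed_vector) \<Rightarrow> real \<Rightarrow> 'a" where
  "dds I f s = vector_derivative f (at s within I)"

definition smooth_on :: "real set \<Rightarrow> (real \<Rightarrow> 'a::real_normed_vector) \<Rightarrow> bool" where
  "smooth_on I f \<longleftrightarrow> (\<forall>n. \<forall>s\<in>I. (dds I ^^ n) f differentiable (at s within I))"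

definition arclength_curve :: "real set \<Rightarrow> (real \<Rightarrow> real^3) \<Rightarrow> bool" where
  "arclength_curve I r \<longleftrightarrow> smooth_on I r \<and> (\<forall>s\<in>I. norm (dds I r s) = 1)"

definition versor_field :: "real set \<Rightarrow> (real \<Rightarrow> real^3) \<Rightarrow> bool" where
  "versor_field I \<xi> \<longleftrightarrow> smooth_on I \<xi> \<and> (\<forall>s\<in>I. norm (\<xi> s) = 1)"

text \<open>
  A plane of the field at the point \<open>P(s)\<close> is represented by its direction, a two-dimensional
  linear subspace. Smoothness is expressed by a smooth unit normal; on an interval a smooth plane
  field always admits a global one.
\<close>

definition plane_field :: "real set \<Rightarrow> (real \<Rightarrow> (real^3) set) \<Rightarrow> bool" where
  "plane_field I \<pi> \<longleftrightarrow>
     (\<exists>\<nu>. versor_field I \<nu> \<and> (\<forall>s\<in>I. \<pi> s = {x. \<nu> s \<bullet> x = 0}))"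

definition myller_configuration ::
  "real set \<Rightarrow> (real \<Rightarrow> real^3) \<Rightarrow> (real \<Rightarrow> real^3) \<Rightarrow> (real \<Rightarrow> (real^3) set) \<Rightarrow> bool" where
  "myller_configuration I r \<xi> \<pi> \<longleftrightarrow>
     is_interval I \<and> interior I \<noteq> {} \<and> arclength_curve I r \<and> versor_field I \<xi> \<and>
     plane_field I \<pi> \<and> (\<forall>s\<in>I. \<xi> s \<in> \<pi> s)"

definition curvature1 :: "real set \<Rightarrow> (real \<Rightarrow> real^3) \<Rightarrow> real \<Rightarrow> real" where
  "curvature1 I \<xi> s = norm (dds I \<xi> s)"

definition frame2 :: "real set \<Rightarrow> (real \<Rightarrow> real^3) \<Rightarrow> real \<Rightarrow> real^3" where
  "frame2 I \<xi> s = (1 / curvature1 I \<xi> s) *\<^sub>R dds I \<xi> s"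

definition frame3 :: "real set \<Rightarrow> (real \<Rightarrow> real^3) \<Rightarrow> real \<Rightarrow> real^3" where
  "frame3 I \<xi> s = cross3 (\<xi> s) (frame2 I \<xi> s)"

text \<open>
  The torsion is the \<open>\<xi>\<^sub>3\<close>-coefficient of \<open>\<xi>\<^sub>2'\<close>; lemma \<open>frenet_formulas\<close> below shows that it is
  the function determined by the Frenet-type equations.
\<close>

definition curvature2 :: "real set \<Rightarrow> (real \<Rightarrow> real^3) \<Rightarrow> real \<Rightarrow> real" where
  "curvature2 I \<xi> s = dds I (frame2 I \<xi>) s \<bullet> frame3 I \<xi> s"

definition vec_angle :: "'a::real_inner \<Rightarrow> 'a \<Rightarrow> real" where
  "vec_angle x y = arccos (x \<bullet> y / (norm x * norm y))"

text \<open>\<open>helix I X\<close> with \<open>X = \<xi>\<^sub>i\<close> says that the curve is a \<open>\<xi>\<^sub>i\<close>-helix.\<close>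

definition helix :: "real set \<Rightarrow> (real \<Rightarrow> real^3) \<Rightarrow> bool" where
  "helix I X \<longleftrightarrow> (\<exists>u \<theta>. norm u = 1 \<and> (\<forall>s\<in>I. vec_angle (X s) u = \<theta>))"

lemma interval_at_within_nontrivial:
  assumes "is_interval I" "interior I \<noteq> {}" "s \<in> I"
  shows "at (s::real) within I \<noteq> bot"
proof -
  have "connected I" using assms(1) is_interval_connected by blast
  moreover have "\<nexists>x. I = {x}" using assms(2) by auto
  ultimately have "s islimpt I" using connected_imp_perfect assms(3) by blast
  then show ?thesis by (simp add: trivial_limit_within)
qed

lemma orthonormal_expansion3:
  fixes a b x :: "real^3"
  assumes "a \<bullet> a = 1" "b \<bullet> b = 1" "a \<bullet> b = 0"
  shows "x = (x \<bullet> a) *\<^sub>R a + (x \<bullet> b) *\<^sub>R b + (x \<bullet> cross3 a b) *\<^sub>R cross3 a b"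
proof -
  let ?c = "cross3 a b"
  define y where "y = x - ((x \<bullet> a) *\<^sub>R a + (x \<bullet> b) *\<^sub>R b + (x \<bullet> ?c) *\<^sub>R ?c)"
  have c: "?c \<bullet> ?c = 1" using dot_cross[of a b a b] assms by (simp add: inner_commute)
  have ca: "a \<bullet> ?c = 0" "b \<bullet> ?c = 0" by (simp_all add: dot_cross_self)
  have y: "y \<bullet> a = 0" "y \<bullet> b = 0" "y \<bullet> ?c = 0"
    using assms c ca by (simp_all add: y_def inner_diff_left inner_add_left inner_diff_right inner_add_right inner_commute)
  have "cross3 y ?c = 0" using y by (simp add: Lagrange)
  then have "(norm y)\<^sup>2 * (norm ?c)\<^sup>2 = 0" using norm_cross[of y ?c] y by simp
  then have "y = 0" using c by auto
  then show ?thesis by (simp add: y_def)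
qed

lemma frenet_formulas:
  assumes M: "myller_configuration I r \<xi> \<pi>" and K: "\<forall>s\<in>I. curvature1 I \<xi> s > 0" and s: "s \<in> I"
  shows "dds I \<xi> s = curvature1 I \<xi> s *\<^sub>R frame2 I \<xi> s"
    and "dds I (frame2 I \<xi>) s = - (curvature1 I \<xi> s) *\<^sub>R \<xi> s + curvature2 I \<xi> s *\<^sub>R frame3 I \<xi> s"
    and "dds I (frame3 I \<xi>) s = - (curvature2 I \<xi> s) *\<^sub>R frame2 I \<xi> s"
proof -
  let ?F = "at s within I" and ?e2 = "frame2 I \<xi>" and ?e3 = "frame3 I \<xi>"
  let ?k1 = "curvature1 I \<xi>" and ?k2 = "curvature2 I \<xi>"
  have nb: "?F \<noteq> bot" "at t within I \<noteq> bot" if "t \<in> I" for t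
    using M s that by (auto simp: myller_configuration_def interval_at_within_nontrivial)
  have sm: "smooth_on I \<xi>" and n1: "\<And>t. t \<in> I \<Longrightarrow> \<xi> t \<bullet> \<xi> t = 1"
    using M by (auto simp: myller_configuration_def versor_field_def norm_eq_1)
  have d: "(\<xi> has_vector_derivative dds I \<xi> t) (at t within I)"
    and dd: "dds I \<xi> differentiable (at t within I)" if "t \<in> I" for t
  proof -
    have "(dds I ^^ 0) \<xi> differentiable (at t within I)" "(dds I ^^ 1) \<xi> differentiable (at t within I)"
      using sm that unfolding smooth_on_def by blast+
    then show "(\<xi> has_vector_derivative dds I \<xi> t) (at t within I)"
      and "dds I \<xi> differentiable (at t within I)"
      by (simp_all add: dds_def vector_derivative_works)
  qed
  have d0: "f' = 0" if "(f has_vector_derivative f') (at t within I)" "t \<in> I" "\<And>u. u \<in> I \<Longrightarrow> f u = c"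
    for f :: "real \<Rightarrow> real" and f' t c
  proof -
    have "((\<lambda>_. c) has_vector_derivative f') (at t within I)"
      using has_vector_derivative_transform[OF that(2) _ that(1)] that(3) by simp
    then show ?thesis
      using vector_derivative_unique_within[OF nb(2)[OF that(2)]] has_vector_derivative_const by blast
  qed
  note ip = bounded_bilinear.has_vector_derivative[OF bounded_bilinear_inner]
  show f1: "dds I \<xi> s = ?k1 s *\<^sub>R ?e2 s"
    using K s by (auto simp: frame2_def)
  have e1d: "\<xi> t \<bullet> dds I \<xi> t = 0" if "t \<in> I" for t
    using d0[OF ip[OF d[OF that] d[OF that]] that n1] by (simp add: inner_commute)
  have n2: "?e2 t \<bullet> ?e2 t = 1" if "t \<in> I" for t
    using K that by (auto simp: frame2_def curvature1_def simp flip: power2_norm_eq_inner)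
  have o12: "\<xi> t \<bullet> ?e2 t = 0" if "t \<in> I" for t
    using e1d[OF that] by (simp add: frame2_def)
  have "dds I \<xi> s \<noteq> 0" using K s by (auto simp: curvature1_def)
  then have "(\<lambda>t. norm (dds I \<xi> t)) differentiable ?F"
    using differentiable_compose[of norm, OF differentiable_norm_at dd[OF s]] by blast
  then have "?e2 differentiable ?F"
    unfolding frame2_def curvature1_def
    using \<open>dds I \<xi> s \<noteq> 0\<close> dd[OF s]
    by (intro differentiable_scaleR differentiable_divide) auto
  then have d2: "(?e2 has_vector_derivative dds I ?e2 s) ?F"
    by (simp add: dds_def vector_derivative_works)
  have a: "dds I ?e2 s \<bullet> ?e2 s = 0"
    using d0[OF ip[OF d2 d2] s n2] by (simp add: inner_commute)
  have "\<xi> s \<bullet> dds I ?e2 s + dds I \<xi> s \<bullet> ?e2 s = 0"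
    by (rule d0[OF ip[OF d[OF s] d2] s o12])
  then have b: "dds I ?e2 s \<bullet> \<xi> s = - ?k1 s"
    using n2[OF s] by (simp add: f1 inner_commute)
  show f2: "dds I ?e2 s = - (?k1 s) *\<^sub>R \<xi> s + ?k2 s *\<^sub>R ?e3 s"
    using orthonormal_expansion3[OF n1[OF s] n2[OF s] o12[OF s], of "dds I ?e2 s"] a b
    by (simp add: curvature2_def frame3_def)
  have "bounded_bilinear cross3"
    using bilinear_cross bilinear_conv_bounded_bilinear by blast
  from bounded_bilinear.has_vector_derivative[OF this d[OF s] d2]
  have "(?e3 has_vector_derivative cross3 (\<xi> s) (dds I ?e2 s) + cross3 (dds I \<xi> s) (?e2 s)) ?F"
    by (simp add: frame3_def[abs_def])
  then have "dds I ?e3 s = cross3 (\<xi> s) (dds I ?e2 s) + cross3 (dds I \<xi> s) (?e2 s)"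
    unfolding dds_def[of I ?e3] using nb[OF s] vector_derivative_within by blast
  also have "\<dots> = ?k2 s *\<^sub>R cross3 (\<xi> s) (?e3 s)"
    by (simp add: f1 f2 cross_add_right cross_mult_right cross_mult_left
        Cross3.right_diff_distrib)
  also have "cross3 (\<xi> s) (?e3 s) = - ?e2 s"
    using n1[OF s] o12[OF s] by (simp add: frame3_def Lagrange)
  finally show "dds I ?e3 s = - (?k2 s) *\<^sub>R ?e2 s" by simp
qed

end

theory Submission
  imports Defs
begin

text \<open>
  Both the helix conditions and the differential equation are equivalent to the constancy of
  \<open>K2 / K1\<close>.

  For helices this is Lancret's theorem (\<open>helix_iff_ratio_constant\<close>). If \<open>\<xi>\<^sub>1\<close> or \<open>\<xi>\<^sub>3\<close> has constant
  inner product with a unit vector \<open>u\<close>, the Frenet-type formulas and the nonvanishing of the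
  curvatures make \<open>\<xi>\<^sub>2\<close> orthogonal to \<open>u\<close>; differentiating \<open>\<xi>\<^sub>2 \<bullet> u = 0\<close> gives the linear relation
  \<open>K1 (\<xi>\<^sub>1 \<bullet> u) = K2 (\<xi>\<^sub>3 \<bullet> u)\<close> with constant inner products. Conversely, if \<open>K2 = m K1\<close>, then
  \<open>m \<xi>\<^sub>1 + \<xi>\<^sub>3\<close> has zero derivative and serves as the axis for both fields.

  For the equation, expand the three derivatives of \<open>\<xi>\<^sub>1\<close> in the frame. The components of the
  left-hand side along \<open>\<xi>\<^sub>2\<close> and \<open>\<xi>\<^sub>3\<close> cancel identically, and the left-hand side equals
  \<open>(K1\<^sup>3 / K2) (K2 / K1)' \<xi>\<^sub>1\<close> (\<open>third_order_expression\<close>). As the parameter set is an interval, this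
  vanishes everywhere exactly if \<open>K2 / K1\<close> is constant.
\<close>

section \<open>Derivatives relative to an interval\<close>

lemma dds_works:
  "f differentiable (at s within I) \<Longrightarrow> (f has_vector_derivative dds I f s) (at s within I)"
  by (simp add: dds_def vector_derivative_works)

text \<open>
  A function known only on \<open>I\<close> can be differentiated through any formula \<open>g\<close> valid there: a
  nondegenerate interval has no isolated points, so the relative derivative is unique.
\<close>

lemma dds_eqI:
  assumes "is_interval I" "interior I \<noteq> {}" "s \<in> I"
    and "(g has_vector_derivative d) (at s within I)"
    and "\<And>t. t \<in> I \<Longrightarrow> f t = g t"
  shows "dds I f s = d"
proof -
  have "(f has_vector_derivative d) (at s within I)"
    using has_vector_derivative_transform[OF assms(3) _ assms(4)] assms(5) by simp
  then show ?thesis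
    unfolding dds_def
    by (rule vector_derivative_within[OF interval_at_within_nontrivial[OF assms(1-3)]])
qed

lemma differentiable_cong_on:
  assumes "g differentiable (at s within I)" "s \<in> I" "\<And>t. t \<in> I \<Longrightarrow> f t = g t"
  shows "f differentiable (at s within I)"
  using differentiable_transform_within[OF assms(1) zero_less_one assms(2)] assms(3) by metis

lemma zero_derivative_imp_constant:
  assumes "is_interval I"
    and "\<And>s. s \<in> I \<Longrightarrow> (f has_vector_derivative 0) (at s within I)"
  shows "\<exists>c. \<forall>s\<in>I. f s = c"
proof -
  have "convex I" using assms(1) by (simp add: is_interval_convex)
  then show ?thesis
    using has_derivative_zero_constant[of I f] assms(2)
    by (auto simp: has_vector_derivative_def)
qed

text \<open>
  Inner products of unit vectors lie in \<open>[-1, 1]\<close>, where \<open>arccos\<close> is injective; so angle and inner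
  product determine each other.
\<close>

lemma helix_iff_inner_constant:
  assumes "\<forall>s\<in>I. norm (X s) = 1"
  shows "helix I X \<longleftrightarrow> (\<exists>u c. norm u = 1 \<and> (\<forall>s\<in>I. X s \<bullet> u = c))"
proof -
  have "cos (vec_angle (X s) u) = X s \<bullet> u" and "vec_angle (X s) u = arccos (X s \<bullet> u)"
    if "norm u = 1" "s \<in> I" for u s
    using assms that Cauchy_Schwarz_ineq2[of "X s" u]
    by (auto simp: vec_angle_def intro!: cos_arccos_abs)
  then show ?thesis unfolding helix_def by metis
qed

section \<open>Lancret's theorem for a Frenet-type frame\<close>

text \<open>
  Here the curvatures are characterized by the Frenet-type equations instead of norms and inner
  products of derivatives, which makes these equations the only source of derivatives below.
\<close>

locale frenet_frame =
  fixes I :: "real set" and e1 e2 e3 :: "real \<Rightarrow> real^3" and K1 K2 :: "real \<Rightarrow> real"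
  assumes interval: "is_interval I" and interior_nonempty: "interior I \<noteq> {}"
    and unit1: "s \<in> I \<Longrightarrow> e1 s \<bullet> e1 s = 1"
    and unit2: "s \<in> I \<Longrightarrow> e2 s \<bullet> e2 s = 1"
    and orth12: "s \<in> I \<Longrightarrow> e1 s \<bullet> e2 s = 0"
    and e3_eq: "s \<in> I \<Longrightarrow> e3 s = cross3 (e1 s) (e2 s)"
    and deriv1: "s \<in> I \<Longrightarrow> (e1 has_vector_derivative K1 s *\<^sub>R e2 s) (at s within I)"
    and deriv2: "s \<in> I \<Longrightarrow>
      (e2 has_vector_derivative - K1 s *\<^sub>R e1 s + K2 s *\<^sub>R e3 s) (at s within I)"
    and deriv3: "s \<in> I \<Longrightarrow> (e3 has_vector_derivative - K2 s *\<^sub>R e2 s) (at s within I)"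
    and K1_pos: "s \<in> I \<Longrightarrow> K1 s > 0"
    and K2_nonzero: "s \<in> I \<Longrightarrow> K2 s \<noteq> 0"
begin

lemma unit3: "s \<in> I \<Longrightarrow> e3 s \<bullet> e3 s = 1"
  using dot_cross[of "e1 s" "e2 s" "e1 s" "e2 s"] unit1 unit2 orth12
  by (simp add: e3_eq inner_commute)

lemma orth13: "s \<in> I \<Longrightarrow> e1 s \<bullet> e3 s = 0"
  by (simp add: e3_eq dot_cross_self)

lemmas dds_eq = dds_eqI[OF interval interior_nonempty]

lemma inner_constant_imp_derivative_zero:
  assumes "s \<in> I" "(f has_vector_derivative d) (at s within I)" "\<And>t. t \<in> I \<Longrightarrow> f t \<bullet> u = c"
  shows "d \<bullet> u = 0"
proof -
  have "((\<lambda>t. f t \<bullet> u) has_vector_derivative d \<bullet> u) (at s within I)"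
    by (rule bounded_linear.has_vector_derivative[OF bounded_linear_inner_left assms(2)])
  from dds_eq[OF assms(1) this, of "\<lambda>_. c"] dds_eq[OF assms(1) has_vector_derivative_const, of "\<lambda>_. c" c]
  show ?thesis using assms(3) by simp
qed

text \<open>
  A direction orthogonal to \<open>e2\<close> has constant components \<open>c\<close> and \<open>d\<close> along \<open>e1\<close> and \<open>e3\<close>, and
  differentiating the orthogonality relation yields \<open>d K2 = c K1\<close>. If \<open>d\<close> vanished, so would \<open>c\<close>
  and hence the direction itself.
\<close>

lemma orthogonal_axis_imp_ratio_constant:
  assumes "norm u = 1" "\<And>s. s \<in> I \<Longrightarrow> e2 s \<bullet> u = 0"
  shows "\<exists>m. \<forall>s\<in>I. K2 s = m * K1 s"
proof -
  have "((\<lambda>t. e1 t \<bullet> u) has_vector_derivative 0) (at s within I)"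
    and "((\<lambda>t. e3 t \<bullet> u) has_vector_derivative 0) (at s within I)" if "s \<in> I" for s
    using bounded_linear.has_vector_derivative[OF bounded_linear_inner_left[of u] deriv1[OF that]]
      bounded_linear.has_vector_derivative[OF bounded_linear_inner_left[of u] deriv3[OF that]]
      assms(2)[OF that] by simp_all
  then obtain c d where c: "\<And>s. s \<in> I \<Longrightarrow> e1 s \<bullet> u = c" and d: "\<And>s. s \<in> I \<Longrightarrow> e3 s \<bullet> u = d"
    using zero_derivative_imp_constant[OF interval] by metis
  have rel: "K2 s * d = K1 s * c" if "s \<in> I" for s
    using inner_constant_imp_derivative_zero[OF that deriv2[OF that] assms(2)] c[OF that] d[OF that]
    by (simp add: inner_add_left inner_diff_left)
  obtain s0 where s0: "s0 \<in> I" using interior_nonempty interior_subset by blast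
  have "d \<noteq> 0"
  proof
    assume "d = 0"
    with rel[OF s0] K1_pos[OF s0] have "c = 0" by simp
    with \<open>d = 0\<close> have "u = 0"
      using orthonormal_expansion3[OF unit1[OF s0] unit2[OF s0] orth12[OF s0], of u]
        c[OF s0] d[OF s0] assms(2)[OF s0] by (simp add: e3_eq[OF s0] inner_commute)
    with assms(1) show False by simp
  qed
  then have "K2 s = (c / d) * K1 s" if "s \<in> I" for s
    using rel[OF that] by (simp add: field_simps)
  then show ?thesis by blast
qed

text \<open>
  The vector \<open>m e1 + e3\<close>, the Darboux vector \<open>K2 e1 + K1 e3\<close> divided by \<open>K1\<close>, has derivative
  \<open>(m K1 - K2) e2 = 0\<close>, so it spans a fixed axis.
\<close>

lemma ratio_constant_imp_axis:
  assumes "\<And>s. s \<in> I \<Longrightarrow> K2 s = m * K1 s"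
  obtains u c d where "norm u = 1" "\<forall>s\<in>I. e1 s \<bullet> u = c" "\<forall>s\<in>I. e3 s \<bullet> u = d"
proof -
  have "((\<lambda>t. m *\<^sub>R e1 t + e3 t) has_vector_derivative
      m *\<^sub>R (K1 s *\<^sub>R e2 s) + (- K2 s *\<^sub>R e2 s)) (at s within I)" if "s \<in> I" for s
    by (intro has_vector_derivative_add deriv3 that
        bounded_linear.has_vector_derivative[OF bounded_linear_scaleR_right] deriv1)
  then have "((\<lambda>t. m *\<^sub>R e1 t + e3 t) has_vector_derivative 0) (at s within I)" if "s \<in> I" for s
    using that assms by force
  then obtain v where v: "\<And>s. s \<in> I \<Longrightarrow> m *\<^sub>R e1 s + e3 s = v"
    using zero_derivative_imp_constant[OF interval, of "\<lambda>t. m *\<^sub>R e1 t + e3 t"] by metis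
  have v1: "e1 s \<bullet> v = m" and v3: "e3 s \<bullet> v = 1" if "s \<in> I" for s
    using that by (simp_all add: v[OF that, symmetric] inner_add_right unit1 unit3 orth13
        inner_commute[of "e3 s" "e1 s"])
  obtain s0 where "s0 \<in> I" using interior_nonempty interior_subset by blast
  then have "v \<noteq> 0" using v3 by force
  then show ?thesis
    using that[of "v /\<^sub>R norm v" "m / norm v" "1 / norm v"] v1 v3 by (simp add: field_simps)
qed

text \<open>
  Differentiating a constant \<open>e1 \<bullet> u\<close> or \<open>e3 \<bullet> u\<close> leaves a nonzero multiple of \<open>e2 \<bullet> u\<close>, so either
  helix condition produces the same orthogonality \<open>e2 \<bullet> u = 0\<close>; and the axis built from a constant
  ratio serves both fields at once.
\<close>

lemma helix_iff_ratio_constant: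
  "helix I e1 \<longleftrightarrow> (\<exists>m. \<forall>s\<in>I. K2 s = m * K1 s)"
  "helix I e3 \<longleftrightarrow> (\<exists>m. \<forall>s\<in>I. K2 s = m * K1 s)"
proof -
  have norms: "\<forall>s\<in>I. norm (e1 s) = 1" "\<forall>s\<in>I. norm (e3 s) = 1"
    using unit1 unit3 by (simp_all add: norm_eq_1)
  have "\<exists>m. \<forall>s\<in>I. K2 s = m * K1 s" if "norm u = 1" "\<forall>s\<in>I. e1 s \<bullet> u = c" for u c
  proof (rule orthogonal_axis_imp_ratio_constant[OF that(1)])
    fix s assume s: "s \<in> I"
    then show "e2 s \<bullet> u = 0"
      using inner_constant_imp_derivative_zero[OF s deriv1[OF s], of u c] that(2) K1_pos[OF s]
      by simp
  qed
  moreover have "\<exists>m. \<forall>s\<in>I. K2 s = m * K1 s" if "norm u = 1" "\<forall>s\<in>I. e3 s \<bullet> u = c" for u c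
  proof (rule orthogonal_axis_imp_ratio_constant[OF that(1)])
    fix s assume s: "s \<in> I"
    then show "e2 s \<bullet> u = 0"
      using inner_constant_imp_derivative_zero[OF s deriv3[OF s], of u c] that(2) K2_nonzero[OF s]
      by simp
  qed
  ultimately show "helix I e1 \<longleftrightarrow> (\<exists>m. \<forall>s\<in>I. K2 s = m * K1 s)"
    and "helix I e3 \<longleftrightarrow> (\<exists>m. \<forall>s\<in>I. K2 s = m * K1 s)"
    unfolding helix_iff_inner_constant[OF norms(1)] helix_iff_inner_constant[OF norms(2)]
    using ratio_constant_imp_axis by metis+
qed

end

section \<open>The third-order equation\<close>

text \<open>
  The third derivative of \<open>e1\<close> involves \<open>K1''\<close> and \<open>K2'\<close>, whence the following regularity.
\<close>

locale regular_frenet_frame = frenet_frame +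
  assumes K1_differentiable: "s \<in> I \<Longrightarrow> K1 differentiable (at s within I)"
    and K1'_differentiable: "s \<in> I \<Longrightarrow> dds I K1 differentiable (at s within I)"
    and K2_differentiable: "s \<in> I \<Longrightarrow> K2 differentiable (at s within I)"
begin

lemma K_derivatives:
  assumes "s \<in> I"
  shows "(K1 has_real_derivative dds I K1 s) (at s within I)"
    and "(dds I K1 has_real_derivative dds I (dds I K1) s) (at s within I)"
    and "(K2 has_real_derivative dds I K2 s) (at s within I)"
  using assms by (simp_all add: has_real_derivative_iff_has_vector_derivative
      dds_works K1_differentiable K1'_differentiable K2_differentiable)

lemma dds_e1: "s \<in> I \<Longrightarrow> dds I e1 s = K1 s *\<^sub>R e2 s"
  using dds_eq deriv1 by blast

lemma dds2_e1:
  assumes "s \<in> I"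
  shows "dds I (dds I e1) s
    = - (K1 s)\<^sup>2 *\<^sub>R e1 s + dds I K1 s *\<^sub>R e2 s + (K1 s * K2 s) *\<^sub>R e3 s"
proof (rule dds_eq[OF assms _ dds_e1])
  show "((\<lambda>t. K1 t *\<^sub>R e2 t) has_vector_derivative
      - (K1 s)\<^sup>2 *\<^sub>R e1 s + dds I K1 s *\<^sub>R e2 s + (K1 s * K2 s) *\<^sub>R e3 s) (at s within I)"
    by (rule has_vector_derivative_eq_rhs[OF has_vector_derivative_scaleR[OF
            K_derivatives(1)[OF assms] deriv2[OF assms]]])
      (simp add: algebra_simps power2_eq_square)
qed

lemma dds3_e1:
  assumes "s \<in> I"
  shows "dds I (dds I (dds I e1)) s
    = (- 3 * K1 s * dds I K1 s) *\<^sub>R e1 s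
      + (dds I (dds I K1) s - (K1 s) ^ 3 - K1 s * (K2 s)\<^sup>2) *\<^sub>R e2 s
      + (2 * dds I K1 s * K2 s + K1 s * dds I K2 s) *\<^sub>R e3 s" (is "_ = ?d")
proof (rule dds_eq[OF assms _ dds2_e1])
  have c1: "((\<lambda>t. - (K1 t)\<^sup>2) has_real_derivative - (2 * K1 s * dds I K1 s)) (at s within I)"
    and c3: "((\<lambda>t. K1 t * K2 t) has_real_derivative dds I K1 s * K2 s + dds I K2 s * K1 s)
        (at s within I)"
    by (auto intro!: derivative_eq_intros K_derivatives[OF assms])
  show "((\<lambda>t. - (K1 t)\<^sup>2 *\<^sub>R e1 t + dds I K1 t *\<^sub>R e2 t + (K1 t * K2 t) *\<^sub>R e3 t)
      has_vector_derivative ?d) (at s within I)"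
    by (rule has_vector_derivative_eq_rhs[OF has_vector_derivative_add[OF has_vector_derivative_add[OF
              has_vector_derivative_scaleR[OF c1 deriv1[OF assms]]
              has_vector_derivative_scaleR[OF K_derivatives(2)[OF assms] deriv2[OF assms]]]
              has_vector_derivative_scaleR[OF c3 deriv3[OF assms]]]])
      (simp add: vec_eq_iff algebra_simps power2_eq_square power3_eq_cube)
qed

text \<open>
  The two coefficients of the equation are exactly those which cancel the \<open>e3\<close>- and
  \<open>e2\<close>-components; what is left along \<open>e1\<close> is the derivative of \<open>K2 / K1\<close> up to the nonzero
  factor \<open>K1\<^sup>3 / K2\<close>.
\<close>

lemma third_order_expression:
  assumes s: "s \<in> I"
  shows "dds I (dds I (dds I e1)) s
      - (dds I (\<lambda>t. K1 t * K2 t) s / (K1 s * K2 s) + dds I K1 s / K1 s) *\<^sub>R dds I (dds I e1) s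
      + (K1 s * K2 s * dds I (\<lambda>t. 1 / K2 t * dds I (\<lambda>x. 1 / K1 x) t) s
          + (K1 s)\<^sup>2 + (K2 s)\<^sup>2) *\<^sub>R dds I e1 s
    = ((K1 s) ^ 3 / K2 s * dds I (\<lambda>t. K2 t / K1 t) s) *\<^sub>R e1 s"
proof -
  note nz = K1_pos[THEN less_imp_neq, THEN not_sym] K2_nonzero
  let ?k = "K1 s" and ?l = "K2 s" and ?k' = "dds I K1 s" and ?k'' = "dds I (dds I K1) s"
    and ?l' = "dds I K2 s"
  have product: "dds I (\<lambda>t. K1 t * K2 t) s = ?k' * ?l + ?k * ?l'"
    by (rule dds_eq[OF s], unfold has_real_derivative_iff_has_vector_derivative[symmetric])
      (auto intro!: derivative_eq_intros K_derivatives[OF s])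
  have ratio: "dds I (\<lambda>t. K2 t / K1 t) s = (?l' * ?k - ?l * ?k') / ?k\<^sup>2"
    by (rule dds_eq[OF s], unfold has_real_derivative_iff_has_vector_derivative[symmetric])
      (auto intro!: derivative_eq_intros K_derivatives[OF s] simp: nz s power2_eq_square)
  have inv: "dds I (\<lambda>x. 1 / K1 x) t = - dds I K1 t / (K1 t)\<^sup>2" if t: "t \<in> I" for t
    by (rule dds_eq[OF t], unfold has_real_derivative_iff_has_vector_derivative[symmetric])
      (auto intro!: derivative_eq_intros K_derivatives[OF t] simp: nz t power2_eq_square)
  have outer: "dds I (\<lambda>t. 1 / K2 t * dds I (\<lambda>x. 1 / K1 x) t) s
      = - ?k'' / (?k\<^sup>2 * ?l) + ?k' * (2 * ?k * ?k' * ?l + ?k\<^sup>2 * ?l') / (?k\<^sup>2 * ?l)\<^sup>2"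
  proof (rule dds_eq[OF s])
    show "((\<lambda>t. - dds I K1 t / ((K1 t)\<^sup>2 * K2 t)) has_vector_derivative
        - ?k'' / (?k\<^sup>2 * ?l) + ?k' * (2 * ?k * ?k' * ?l + ?k\<^sup>2 * ?l') / (?k\<^sup>2 * ?l)\<^sup>2) (at s within I)"
      unfolding has_real_derivative_iff_has_vector_derivative[symmetric]
      by (rule derivative_eq_intros K_derivatives[OF s] refl | simp add: nz s)+
        (simp add: nz s field_simps power2_eq_square)
  qed (simp add: inv)
  let ?A = "(?k' * ?l + ?k * ?l') / (?k * ?l) + ?k' / ?k"
  let ?B = "?k * ?l * (- ?k'' / (?k\<^sup>2 * ?l) + ?k' * (2 * ?k * ?k' * ?l + ?k\<^sup>2 * ?l') / (?k\<^sup>2 * ?l)\<^sup>2)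
      + ?k\<^sup>2 + ?l\<^sup>2"
  have k: "?k \<noteq> 0" and l: "?l \<noteq> 0" using nz s by auto
  have along1: "- 3 * ?k * ?k' - ?A * - ?k\<^sup>2 = ?k ^ 3 / ?l * ((?l' * ?k - ?l * ?k') / ?k\<^sup>2)"
    using k l by (simp add: field_simps power2_eq_square power3_eq_cube)
  have along2: "?k'' - ?k ^ 3 - ?k * ?l\<^sup>2 - ?A * ?k' + ?B * ?k = 0"
    using k l by (simp add: field_simps power2_eq_square power3_eq_cube)
  have along3: "2 * ?k' * ?l + ?k * ?l' - ?A * (?k * ?l) = 0"
    using k l by (simp add: field_simps)
  \<comment> \<open>A single instance of this regrouping turns the claim into the three scalar identities above.\<close>
  have collect: "(a1 *\<^sub>R e1 s + a2 *\<^sub>R e2 s + a3 *\<^sub>R e3 s)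
      - A *\<^sub>R (b1 *\<^sub>R e1 s + b2 *\<^sub>R e2 s + b3 *\<^sub>R e3 s) + B *\<^sub>R (?k *\<^sub>R e2 s)
    = (a1 - A * b1) *\<^sub>R e1 s + (a2 - A * b2 + B * ?k) *\<^sub>R e2 s + (a3 - A * b3) *\<^sub>R e3 s"
    for a1 a2 a3 b1 b2 b3 A B
    by (simp add: algebra_simps)
  show ?thesis
    unfolding dds3_e1[OF s] dds2_e1[OF s] dds_e1[OF s] product ratio outer collect
      along1 along2 along3
    by simp
qed

text \<open>
  Since \<open>e1\<close> and the factor \<open>K1\<^sup>3 / K2\<close> never vanish, the equation says that \<open>K2 / K1\<close> has zero
  derivative on the interval.
\<close>

lemma ratio_constant_iff_third_order_equation:
  "(\<exists>m. \<forall>s\<in>I. K2 s = m * K1 s) \<longleftrightarrow>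
    (\<forall>s\<in>I. dds I (dds I (dds I e1)) s
      - (dds I (\<lambda>t. K1 t * K2 t) s / (K1 s * K2 s) + dds I K1 s / K1 s) *\<^sub>R dds I (dds I e1) s
      + (K1 s * K2 s * dds I (\<lambda>t. 1 / K2 t * dds I (\<lambda>x. 1 / K1 x) t) s
          + (K1 s)\<^sup>2 + (K2 s)\<^sup>2) *\<^sub>R dds I e1 s = 0)"
    (is "?ratio \<longleftrightarrow> (\<forall>s\<in>I. ?E s = 0)")
proof -
  have K1_nz: "K1 s \<noteq> 0" if "s \<in> I" for s using K1_pos[OF that] by simp
  have E: "?E s = 0 \<longleftrightarrow> dds I (\<lambda>t. K2 t / K1 t) s = 0" if "s \<in> I" for s
    using third_order_expression[OF that] K1_nz[OF that] K2_nonzero[OF that] unit1[OF that] by auto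
  have "?ratio \<longleftrightarrow> (\<exists>m. \<forall>s\<in>I. K2 s / K1 s = m)"
    using K1_nz by (simp add: nonzero_divide_eq_eq)
  also have "\<dots> \<longleftrightarrow> (\<forall>s\<in>I. dds I (\<lambda>t. K2 t / K1 t) s = 0)"
  proof
    assume "\<exists>m. \<forall>s\<in>I. K2 s / K1 s = m"
    then obtain m where m: "\<forall>s\<in>I. K2 s / K1 s = m" by blast
    then show "\<forall>s\<in>I. dds I (\<lambda>t. K2 t / K1 t) s = 0"
      using dds_eq[OF _ has_vector_derivative_const[of m], of _ "\<lambda>t. K2 t / K1 t"] by blast
  next
    assume zero: "\<forall>s\<in>I. dds I (\<lambda>t. K2 t / K1 t) s = 0"
    have "(\<lambda>t. K2 t / K1 t) differentiable (at s within I)" if "s \<in> I" for s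
      using K1_differentiable K2_differentiable K1_nz that by (intro differentiable_divide) auto
    then show "\<exists>m. \<forall>s\<in>I. K2 s / K1 s = m"
      using zero dds_works[of "\<lambda>t. K2 t / K1 t"]
      by (intro zero_derivative_imp_constant[OF interval]) fastforce
  qed
  finally show ?thesis using E by simp
qed

end

section \<open>The frame of a Myller configuration\<close>

text \<open>
  The Frenet-type formulas only identify the values of \<open>dds\<close>; what remains is the differentiability
  of the frame and of the curvatures. It descends from three derivatives of \<open>\<xi>\<close>: \<open>K1\<close> is the root of
  the nonvanishing function \<open>\<xi>' \<bullet> \<xi>'\<close>, its derivative is \<open>(\<xi>' \<bullet> \<xi>'') / K1\<close>, and the derivative of
  \<open>\<xi>\<^sub>2 = \<xi>' / K1\<close>, which enters \<open>K2\<close>, is again a differentiable expression in these.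
\<close>

lemma myller_regular_frenet_frame:
  assumes M: "myller_configuration I r \<xi> \<pi>"
    and K1_pos: "\<forall>s\<in>I. curvature1 I \<xi> s > 0"
    and K2_nonzero: "\<forall>s\<in>I. curvature2 I \<xi> s \<noteq> 0"
  shows "regular_frenet_frame I \<xi> (frame2 I \<xi>) (frame3 I \<xi>) (curvature1 I \<xi>) (curvature2 I \<xi>)"
proof -
  let ?e2 = "frame2 I \<xi>" and ?e3 = "frame3 I \<xi>" and ?k1 = "curvature1 I \<xi>" and ?k2 = "curvature2 I \<xi>"
  let ?d1 = "dds I \<xi>" let ?d2 = "dds I ?d1"
  have int: "is_interval I" "interior I \<noteq> {}"
    and smooth: "smooth_on I \<xi>" and unit: "\<And>s. s \<in> I \<Longrightarrow> \<xi> s \<bullet> \<xi> s = 1"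
    using M by (auto simp: myller_configuration_def versor_field_def norm_eq_1)
  note dds_eq = dds_eqI[OF int]
  have diff: "\<xi> differentiable (at s within I)" "?d1 differentiable (at s within I)"
    "?d2 differentiable (at s within I)" if "s \<in> I" for s
  proof -
    have "(dds I ^^ 0) \<xi> differentiable (at s within I)" "(dds I ^^ 1) \<xi> differentiable (at s within I)"
      "(dds I ^^ 2) \<xi> differentiable (at s within I)"
      using smooth that unfolding smooth_on_def by blast+
    then show "\<xi> differentiable (at s within I)" "?d1 differentiable (at s within I)"
      "?d2 differentiable (at s within I)" by (simp_all add: numeral_2_eq_2)
  qed
  have k1_nz: "?k1 s \<noteq> 0" if "s \<in> I" for s using K1_pos that by auto
  have e1_d1: "\<xi> s \<bullet> ?d1 s = 0" if "s \<in> I" for s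
  proof -
    have "((\<lambda>t. \<xi> t \<bullet> \<xi> t) has_vector_derivative \<xi> s \<bullet> ?d1 s + ?d1 s \<bullet> \<xi> s) (at s within I)"
      using bounded_bilinear.has_vector_derivative[OF bounded_bilinear_inner] diff(1)[OF that]
        dds_works by blast
    from dds_eq[OF that this, of "\<lambda>_. 1"] dds_eq[OF that has_vector_derivative_const[of "1::real"], of "\<lambda>_. 1"]
    show ?thesis by (simp add: unit inner_commute)
  qed
  have k1_sqrt: "?k1 = (\<lambda>t. sqrt (?d1 t \<bullet> ?d1 t))"
    by (simp add: fun_eq_iff curvature1_def norm_eq_sqrt_inner)
  have k1_deriv: "(?k1 has_real_derivative (?d1 s \<bullet> ?d2 s) / ?k1 s) (at s within I)" if s: "s \<in> I" for s
  proof -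
    note d2 = dds_works[OF diff(2)[OF s]]
    have sq: "((\<lambda>t. ?d1 t \<bullet> ?d1 t) has_real_derivative ?d1 s \<bullet> ?d2 s + ?d2 s \<bullet> ?d1 s) (at s within I)"
      unfolding has_real_derivative_iff_has_vector_derivative
      by (rule bounded_bilinear.has_vector_derivative[OF bounded_bilinear_inner d2 d2])
    have pos: "?d1 s \<bullet> ?d1 s > 0" using K1_pos s by (auto simp: curvature1_def)
    then have "inverse (sqrt (?d1 s \<bullet> ?d1 s)) / 2 * (?d1 s \<bullet> ?d2 s + ?d2 s \<bullet> ?d1 s)
        = (?d1 s \<bullet> ?d2 s) / sqrt (?d1 s \<bullet> ?d1 s)"
      by (simp add: inner_commute[of "?d2 s"] inverse_eq_divide)
    then show ?thesis
      unfolding k1_sqrt using DERIV_cong[OF DERIV_chain2[OF DERIV_real_sqrt[OF pos] sq]] by blast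
  qed
  have k1_dds: "dds I ?k1 s = (?d1 s \<bullet> ?d2 s) / ?k1 s" if "s \<in> I" for s
    by (rule dds_eq[OF that k1_deriv[OF that, unfolded has_real_derivative_iff_has_vector_derivative] refl])
  have k1_diff: "?k1 differentiable (at s within I)" if "s \<in> I" for s
    using k1_deriv[OF that] real_differentiable_def by blast
  have k1'_diff: "dds I ?k1 differentiable (at s within I)" if s: "s \<in> I" for s
    by (rule differentiable_cong_on[OF _ s k1_dds])
      (intro differentiable_divide differentiable_inner diff k1_diff k1_nz s)
  have e2_deriv: "(?e2 has_vector_derivative
      (1 / ?k1 s) *\<^sub>R ?d2 s + (- dds I ?k1 s / (?k1 s * ?k1 s)) *\<^sub>R ?d1 s) (at s within I)"
    if s: "s \<in> I" for s
  proof -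
    have "((\<lambda>t. 1 / ?k1 t) has_real_derivative - dds I ?k1 s / (?k1 s * ?k1 s)) (at s within I)"
      using k1_nz[OF s] k1_dds[OF s] by (auto intro!: derivative_eq_intros k1_deriv[OF s])
    from has_vector_derivative_scaleR[OF this dds_works[OF diff(2)[OF s]]]
    show ?thesis by (simp add: frame2_def[abs_def])
  qed
  note e2_dds = dds_eq[OF _ e2_deriv refl]
  have e2_works: "(?e2 has_vector_derivative dds I ?e2 s) (at s within I)" if "s \<in> I" for s
    using e2_deriv[OF that] e2_dds[OF that that] by simp
  have e2'_diff: "dds I ?e2 differentiable (at s within I)" if s: "s \<in> I" for s
    by (rule differentiable_cong_on[OF _ s e2_dds])
      (auto intro!: derivative_intros differentiable_divide diff k1_diff k1'_diff s simp: k1_nz s)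
  have "bounded_bilinear cross3"
    using bilinear_cross bilinear_conv_bounded_bilinear by blast
  note cross_deriv = bounded_bilinear.has_vector_derivative[OF this]
  have e3_works: "(?e3 has_vector_derivative dds I ?e3 s) (at s within I)" if s: "s \<in> I" for s
  proof -
    have "(?e3 has_vector_derivative cross3 (\<xi> s) (dds I ?e2 s) + cross3 (?d1 s) (?e2 s)) (at s within I)"
      using cross_deriv[OF dds_works[OF diff(1)[OF s]] e2_works[OF s]]
      by (simp add: frame3_def[abs_def])
    with dds_eq[OF s this refl] show ?thesis by simp
  qed
  have k2_diff: "?k2 differentiable (at s within I)" if s: "s \<in> I" for s
    unfolding curvature2_def[abs_def]
    using e3_works[OF s] by (intro differentiable_inner e2'_diff s differentiableI_vector)
  note frenet = frenet_formulas[OF M K1_pos]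
  show ?thesis
  proof
    fix s assume s: "s \<in> I"
    show "?e2 s \<bullet> ?e2 s = 1"
      using k1_nz[OF s] by (auto simp: frame2_def curvature1_def simp flip: power2_norm_eq_inner)
    show "\<xi> s \<bullet> ?e2 s = 0" using e1_d1[OF s] by (simp add: frame2_def)
    show "(\<xi> has_vector_derivative ?k1 s *\<^sub>R ?e2 s) (at s within I)"
      using dds_works[OF diff(1)[OF s]] frenet(1)[OF s] by simp
    show "(?e2 has_vector_derivative - ?k1 s *\<^sub>R \<xi> s + ?k2 s *\<^sub>R ?e3 s) (at s within I)"
      using e2_works[OF s] frenet(2)[OF s] by simp
    show "(?e3 has_vector_derivative - ?k2 s *\<^sub>R ?e2 s) (at s within I)"
      using e3_works[OF s] frenet(3)[OF s] by simp
  qed (use int unit K1_pos K2_nonzero k1_diff k1'_diff k2_diff in \<open>auto simp: frame3_def\<close>)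
qed

theorem corollary20:
  fixes I :: "real set" and r \<xi> :: "real \<Rightarrow> real^3" and \<pi> :: "real \<Rightarrow> (real^3) set"
    and K1 K2 :: "real \<Rightarrow> real"
  defines "K1 \<equiv> curvature1 I \<xi>" and "K2 \<equiv> curvature2 I \<xi>"
  assumes "myller_configuration I r \<xi> \<pi>"
    and "\<forall>s\<in>I. K1 s > 0"
    and "\<forall>s\<in>I. K2 s \<noteq> 0"
  shows "(helix I \<xi> \<longleftrightarrow> helix I (frame3 I \<xi>)) \<and>
    (helix I \<xi> \<longleftrightarrow>
      (\<forall>s\<in>I.
        (dds I ^^ 3) \<xi> s
        - (dds I (\<lambda>t. K1 t * K2 t) s / (K1 s * K2 s) + dds I K1 s / K1 s) *\<^sub>R (dds I ^^ 2) \<xi> s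
        + (K1 s * K2 s * dds I (\<lambda>t. 1 / K2 t * dds I (\<lambda>x. 1 / K1 x) t) s
            + (K1 s)\<^sup>2 + (K2 s)\<^sup>2) *\<^sub>R dds I \<xi> s = 0))"
proof -
  interpret regular_frenet_frame I \<xi> "frame2 I \<xi>" "frame3 I \<xi>" K1 K2
    unfolding K1_def K2_def
    using myller_regular_frenet_frame assms(3) assms(4,5)[unfolded K1_def K2_def] by blast
  have powers: "(dds I ^^ 3) \<xi> = dds I (dds I (dds I \<xi>))" "(dds I ^^ 2) \<xi> = dds I (dds I \<xi>)"
    by (simp_all add: numeral_3_eq_3 numeral_2_eq_2)
  show ?thesis
    unfolding powers helix_iff_ratio_constant ratio_constant_iff_third_order_equation by simp
qed

end
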